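(* There exists a randomized algorithm for asymmetric streaming pattern matching that, given a text $T$ with $|T|=n$ accessible by value queries and a pattern $P$ with $|P|=m$ arriving as a stream, makes a single pass over $P$, uses memory $O(1)$, runs in time $O(n+m)$, and correctly decides whether $P$ appears as a substring of $T$ with probability at least $0.99$.
   Context: Asymmetric streaming pattern matching: a text $T$ over a finite alphabet $\Sigma$ is available via value queries (in each query one gives an index $i$ and receives the $i$-th character of $T$), and a pattern $P$ over $\Sigma$ arrives as a stream of characters, read in order. The goal is to decide whether $P$ appears as a (contiguous) substring of $T$. Memory is measured in machine words (each able to hold an index or a number polynomial in $n$), not counting the read-only access to $T$. *)

theory Defs
  imports "HOL-Probability.Probability" "HOL-Library.Sublist"
begin

text \<open>A randomized word-RAM with a constant number of registers (those named in the
fixed program), unit-cost instructions, read-only value-query access to the text T,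
and one-way (single pass) read access to the pattern stream P.  Alphabet symbols are
encoded as naturals below sigma.  Registers are indexed by naturals; register 0
initially holds n = |T|, all others hold 0.\<close>

datatype aop = Add | Sub | Mul | Div | Mod

datatype instr =
    Const nat nat            \<comment> \<open>Const i v: R i := v\<close>
  | Arith aop nat nat nat    \<comment> \<open>Arith op i j l: R i := op (R j) (R l)\<close>
  | Goto nat
  | Jlt nat nat nat          \<comment> \<open>Jlt j l t: if R j < R l then goto t\<close>
  | Query nat nat            \<comment> \<open>Query i j: R i := T[R j] (0 if out of range)\<close>
  | Read nat nat             \<comment> \<open>Read i t: if stream exhausted goto t, else R i := next symbol\<close>
  | Rand nat nat             \<comment> \<open>Rand i j: R i := uniform in {0..<R j} (0 if R j = 0)\<close>
  | Accept
  | Reject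

datatype result = Acc | Rej | Fail

fun aop_sem :: "aop \<Rightarrow> nat \<Rightarrow> nat \<Rightarrow> nat" where
  "aop_sem Add a b = a + b"
| "aop_sem Sub a b = a - b"
| "aop_sem Mul a b = a * b"
| "aop_sem Div a b = a div b"
| "aop_sem Mod a b = a mod b"

text \<open>run prog T B f pc R S: outcome distribution when at most f steps remain,
every register value must stay below the word bound B (otherwise Fail),
and S is the unread remainder of the pattern stream.\<close>

fun run :: "instr list \<Rightarrow> nat list \<Rightarrow> nat \<Rightarrow> nat \<Rightarrow> nat \<Rightarrow> (nat \<Rightarrow> nat) \<Rightarrow> nat list
             \<Rightarrow> result pmf" where
  "run prog T B 0 pc R S = return_pmf Fail"
| "run prog T B (Suc f) pc R S =
    (if length prog \<le> pc then return_pmf Fail else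
     (case prog ! pc of
        Const i v \<Rightarrow>
          (if v < B then run prog T B f (Suc pc) (R(i := v)) S else return_pmf Fail)
      | Arith op i j l \<Rightarrow>
          (if aop_sem op (R j) (R l) < B
           then run prog T B f (Suc pc) (R(i := aop_sem op (R j) (R l))) S
           else return_pmf Fail)
      | Goto t \<Rightarrow> run prog T B f t R S
      | Jlt j l t \<Rightarrow> (if R j < R l then run prog T B f t R S else run prog T B f (Suc pc) R S)
      | Query i j \<Rightarrow>
          (let v = (if R j < length T then T ! (R j) else 0) in
           if v < B then run prog T B f (Suc pc) (R(i := v)) S else return_pmf Fail)
      | Read i t \<Rightarrow>
          (case S of
             [] \<Rightarrow> run prog T B f t R []
           | x # xs \<Rightarrow> (if x < B then run prog T B f (Suc pc) (R(i := x)) xs else return_pmf Fail))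
      | Rand i j \<Rightarrow>
          bind_pmf (if R j = 0 then return_pmf 0 else pmf_of_set {..<R j})
            (\<lambda>v. if v < B then run prog T B f (Suc pc) (R(i := v)) S else return_pmf Fail)
      | Accept \<Rightarrow> return_pmf Acc
      | Reject \<Rightarrow> return_pmf Rej))"

definition outcome :: "instr list \<Rightarrow> nat list \<Rightarrow> nat list \<Rightarrow> nat \<Rightarrow> nat \<Rightarrow> result pmf" where
  "outcome prog T P B f = run prog T B f 0 ((\<lambda>_. 0)(0 := length T)) P"

end

(* Rabin-Karp: since the part of the pattern read so far is only compared through its
   fingerprint, it suffices to slide a window over T that grows by one symbol with every symbol
   read and moves right while its fingerprint differs; both kinds of step are amortised O(1).
   The fingerprint is polynomial evaluation at a random point r of Z/q.  No prime is needed: a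
   uniform q \<le> M = y^2000 has a prime factor p > y with probability at least 0.995, and then
   evaluation modulo p already separates distinct words except for few r.  That few q are
   y-smooth follows by double counting prime factors: the sum of ln q over the y-smooth q \<le> M
   is at most the sum over p \<le> y of ln p * v_p(M!), which is at most 4 M ln y. *)
theory Submission
  imports Defs "HOL-Computational_Algebra.Computational_Algebra"
begin

section \<open>Smooth numbers\<close>

text \<open>Double counting of the pairs (a, q) with p ^ a dividing q. This is Legendre's formula
  for the exponent of p in M!, bounded by a geometric series of ratio at most 1/2.\<close>

lemma sum_multiplicity_le:
  fixes p M :: nat
  assumes p: "prime p"
  shows "real (\<Sum>q = 1..M. multiplicity p q) \<le> 2 * real M / real p"
proof -
  have card: "multiplicity p q = card {a \<in> {1..M}. p ^ a dvd q}" if q: "q \<in> {1..M}" for q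
  proof -
    have "{a \<in> {1..M}. p ^ a dvd q} = {1..multiplicity p q}"
    proof (intro set_eqI iffI)
      fix a assume "a \<in> {a \<in> {1..M}. p ^ a dvd q}"
      then show "a \<in> {1..multiplicity p q}"
        using q p by (auto intro!: multiplicity_geI)
    next
      fix a assume a: "a \<in> {1..multiplicity p q}"
      then have dvd: "p ^ a dvd q" by (intro multiplicity_dvd') auto
      \<comment> \<open>Hence every exponent that occurs is at most M, and one range {1..M} serves
        for all q.\<close>
      have "a < p ^ a" using prime_gt_1_nat[OF p] by (intro power_gt_expt) simp
      also have "\<dots> \<le> M" using dvd_imp_le[OF dvd] q by simp
      finally show "a \<in> {a \<in> {1..M}. p ^ a dvd q}" using a dvd by auto
    qed
    then show ?thesis by simp
  qed
  have "(\<Sum>q = 1..M. multiplicity p q) = (\<Sum>q = 1..M. \<Sum>a = 1..M. if p ^ a dvd q then 1 else 0)"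
    using card by (intro sum.cong refl) (simp add: sum.If_cases Int_def)
  also have "\<dots> = (\<Sum>a = 1..M. \<Sum>q = 1..M. if p ^ a dvd q then 1 else 0)"
    by (rule sum.swap)
  also have "\<dots> = (\<Sum>a = 1..M. card {q \<in> {1..M}. p ^ a dvd q})"
    by (simp add: sum.If_cases Int_def)
  also have "\<dots> = (\<Sum>a = 1..M. M div p ^ a)"
  proof (intro sum.cong refl)
    fix a
    have "{q \<in> {1..M}. p ^ a dvd q} = (\<lambda>j. p ^ a * j) ` {1..M div p ^ a}"
      using prime_gt_0_nat[OF p] by (auto simp: dvd_def image_iff less_eq_div_iff_mult_less_eq mult.commute)
    moreover have "inj_on (\<lambda>j. p ^ a * j) {1..M div p ^ a}"
      using prime_gt_0_nat[OF p] by (auto intro!: inj_onI)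
    ultimately show "card {q \<in> {1..M}. p ^ a dvd q} = M div p ^ a"
      by (simp add: card_image)
  qed
  finally have eq: "real (\<Sum>q = 1..M. multiplicity p q) = (\<Sum>a = 1..M. real (M div p ^ a))" by simp
  have p2: "2 \<le> real p" using prime_ge_2_nat[OF p] by simp
  have "(\<Sum>a = 1..M. real (M div p ^ a)) \<le> (\<Sum>a = 1..M. real M * (1 / real p) ^ a)"
    by (intro sum_mono order.trans[OF of_nat_div_le_of_nat]) (simp add: divide_inverse power_inverse)
  also have "\<dots> = real M * ((1 / real p) * (\<Sum>a<M. (1 / real p) ^ a))"
    by (simp add: sum_distrib_left sum.atLeast1_atMost_eq mult_ac)
  also have "\<dots> \<le> real M * ((1 / real p) * 2)"
  proof -
    have "(\<Sum>a<M. (1 / real p) ^ a) \<le> (\<Sum>a<M. (1 / 2) ^ a)"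
      using p2 by (intro sum_mono power_mono) (auto simp: field_simps)
    also have "\<dots> \<le> 2" by (simp add: geometric_sum)
    finally show ?thesis by (intro mult_left_mono) auto
  qed
  finally show ?thesis using eq by (simp add: field_simps)
qed

definition smooth_upto :: "nat \<Rightarrow> nat \<Rightarrow> nat set" where
  "smooth_upto y M = {q \<in> {1..M}. \<forall>p. prime p \<longrightarrow> p dvd q \<longrightarrow> p \<le> y}"

text \<open>Logarithm of the prime factorization. Smoothness allows an index set independent of q,
  so that sums over q and over p can be exchanged.\<close>

lemma ln_smooth:
  assumes "q \<in> smooth_upto y M"
  shows "ln (real q) = (\<Sum>p | prime p \<and> p \<le> y. real (multiplicity p q) * ln (real p))"
proof -
  let ?A = "{p. prime p \<and> p \<le> y}"
  have fin: "finite ?A" by (rule finite_subset[of _ "{..y}"]) auto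
  have q0: "0 < q" and sub: "prime_factors q \<subseteq> ?A"
    using assms by (auto simp: smooth_upto_def prime_factors_dvd)
  have "q = (\<Prod>p\<in>prime_factors q. p ^ multiplicity p q)"
    using q0 by (rule prime_factorization_nat)
  also have "\<dots> = (\<Prod>p\<in>?A. p ^ multiplicity p q)"
    using fin sub by (intro prod.mono_neutral_left) (auto simp: prime_factors_multiplicity)
  finally have "ln (real q) = ln (\<Prod>p\<in>?A. real p ^ multiplicity p q)"
    by (metis (no_types, lifting) of_nat_power of_nat_prod prod.cong)
  also have "\<dots> = (\<Sum>p\<in>?A. real (multiplicity p q) * ln (real p))"
    using fin prime_gt_0_nat by (subst ln_prod) (auto simp: ln_realpow)
  finally show ?thesis .
qed

text \<open>A weak form of Mertens' first theorem. The sum of \<open>y div p\<close> times ln p is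
  at most ln y!, hence at most y ln y, and rounding y / p down loses at most a factor 2 because
  \<open>y div p\<close> \<ge> 1.\<close>

lemma sum_ln_prime_div_le:
  fixes y :: nat
  assumes "0 < y"
  shows "(\<Sum>p | prime p \<and> p \<le> y. ln (real p) / real p) \<le> 2 * ln (real y)"
proof -
  let ?A = "{p. prime p \<and> p \<le> y}"
  have fin: "finite ?A" by (rule finite_subset[of _ "{..y}"]) auto
  have "(\<Sum>p\<in>?A. real (y div p) * ln (real p)) = (\<Sum>p\<in>?A. \<Sum>j = 1..y. if p dvd j then ln (real p) else 0)"
  proof (intro sum.cong refl)
    fix p assume "p \<in> ?A"
    then have p: "0 < p" using prime_gt_0_nat by auto
    have "{q \<in> {1..y}. p dvd q} = (\<lambda>j. p * j) ` {1..y div p}"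
      using p by (auto simp: dvd_def image_iff less_eq_div_iff_mult_less_eq mult.commute)
    moreover have "inj_on (\<lambda>j. p * j) {1..y div p}"
      using p by (auto intro!: inj_onI)
    ultimately have "card {q \<in> {1..y}. p dvd q} = y div p"
      by (simp add: card_image)
    then show "real (y div p) * ln (real p) = (\<Sum>j = 1..y. if p dvd j then ln (real p) else 0)"
      by (simp add: sum.If_cases Int_def)
  qed
  also have "\<dots> = (\<Sum>j = 1..y. \<Sum>p\<in>?A. if p dvd j then ln (real p) else 0)"
    by (rule sum.swap)
  also have "\<dots> \<le> (\<Sum>j = 1..y. ln (real j))"
  proof (intro sum_mono)
    fix j assume j: "j \<in> {1..y}"
    \<comment> \<open>Each j up to y is trivially y-smooth, so its logarithm factors; keeping one
      copy of ln p per prime divisor gives a lower bound.\<close>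
    then have "j \<in> smooth_upto y y" by (auto simp: smooth_upto_def dest: dvd_imp_le)
    then have "ln (real j) = (\<Sum>p\<in>?A. real (multiplicity p j) * ln (real p))" by (rule ln_smooth)
    moreover have "(if p dvd j then ln (real p) else 0) \<le> real (multiplicity p j) * ln (real p)" if p: "p \<in> ?A" for p
    proof -
      have "1 \<le> multiplicity p j" if "p dvd j"
        using that p j by (intro multiplicity_geI) auto
      moreover have "0 \<le> ln (real p)" using p prime_gt_0_nat by (auto simp: Suc_leI)
      ultimately show ?thesis using mult_right_mono[of 1 "real (multiplicity p j)" "ln (real p)"] by auto
    qed
    ultimately show "(\<Sum>p\<in>?A. if p dvd j then ln (real p) else 0) \<le> ln (real j)"
      by (metis (no_types, lifting) sum_mono)
  qed
  also have "\<dots> \<le> (\<Sum>j = 1..y. ln (real y))"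
    by (intro sum_mono) auto
  finally have *: "(\<Sum>p\<in>?A. real (y div p) * ln (real p)) \<le> real y * ln (real y)" by simp
  have "real y * (\<Sum>p\<in>?A. ln (real p) / real p) \<le> (\<Sum>p\<in>?A. 2 * (real (y div p) * ln (real p)))"
    unfolding sum_distrib_left
  proof (intro sum_mono)
    fix p assume p: "p \<in> ?A"
    then have p0: "0 < p" and ge: "1 \<le> y div p"
      using prime_gt_0_nat by (auto simp: Suc_le_eq div_greater_zero_iff)
    have "y = p * (y div p) + y mod p" by simp
    also have "\<dots> \<le> p * (y div p) + p * (y div p)"
      using p0 ge by (intro add_left_mono) (metis less_imp_le mod_less_divisor mult_le_mono2 nat_mult_1_right order.trans)
    finally have "real y \<le> real p * (2 * real (y div p))"
      by (metis mult.left_commute mult_2 of_nat_le_iff of_nat_mult of_nat_numeral)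
    then have "real y / real p \<le> 2 * real (y div p)"
      using p0 by (simp add: field_simps)
    then have "real y / real p * ln (real p) \<le> 2 * real (y div p) * ln (real p)"
      using p0 by (intro mult_right_mono) auto
    then show "real y * (ln (real p) / real p) \<le> 2 * (real (y div p) * ln (real p))"
      by simp
  qed
  also have "\<dots> \<le> 2 * (real y * ln (real y))"
    using * by (simp flip: sum_distrib_left)
  finally show ?thesis using assms by (simp add: field_simps)
qed

text \<open>Once the logarithms are factored, letting q range over all of {1..M} only adds
  nonnegative terms. Each prime then contributes ln p times its exponent in M!, and the Mertens-type
  bound sums these up.\<close>

lemma sum_ln_smooth_le:
  assumes "0 < y"
  shows "(\<Sum>q \<in> smooth_upto y M. ln (real q)) \<le> 4 * real M * ln (real y)"
proof -
  let ?A = "{p. prime p \<and> p \<le> y}"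
  have "(\<Sum>q \<in> smooth_upto y M. ln (real q))
      = (\<Sum>q \<in> smooth_upto y M. \<Sum>p\<in>?A. real (multiplicity p q) * ln (real p))"
    by (intro sum.cong refl ln_smooth)
  also have "\<dots> \<le> (\<Sum>q = 1..M. \<Sum>p\<in>?A. real (multiplicity p q) * ln (real p))"
    using prime_gt_0_nat
    by (intro sum_mono2) (auto simp: smooth_upto_def Suc_leI intro!: sum_nonneg)
  also have "\<dots> = (\<Sum>p\<in>?A. real (\<Sum>q = 1..M. multiplicity p q) * ln (real p))"
    by (subst sum.swap) (simp add: sum_distrib_right)
  also have "\<dots> \<le> (\<Sum>p\<in>?A. 2 * real M / real p * ln (real p))"
    using prime_gt_0_nat by (intro sum_mono mult_right_mono sum_multiplicity_le) (auto simp: Suc_leI)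
  also have "\<dots> = 2 * real M * (\<Sum>p\<in>?A. ln (real p) / real p)"
    by (simp add: sum_distrib_left)
  also have "\<dots> \<le> 2 * real M * (2 * ln (real y))"
    using assms by (intro mult_left_mono sum_ln_prime_div_le) auto
  finally show ?thesis by simp
qed

text \<open>Markov's inequality: each smooth number from y ^ h on contributes at least h ln y to the
  sum of logarithms. The smaller ones are counted trivially.\<close>

lemma card_smooth_upto_le:
  assumes y: "2 \<le> y" and h: "0 < h"
  shows "real (card (smooth_upto y M)) \<le> 4 * real M / real h + real y ^ h"
proof -
  let ?L = "{q \<in> smooth_upto y M. y ^ h \<le> q}"
  have fin: "finite (smooth_upto y M)" by (simp add: smooth_upto_def)
  have lny: "0 < ln (real y)" using y by simp
  have "real (card ?L) * (real h * ln (real y)) = (\<Sum>q\<in>?L. ln (real (y ^ h)))"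
    using y by (simp add: ln_realpow)
  also have "\<dots> \<le> (\<Sum>q\<in>?L. ln (real q))"
  proof (intro sum_mono)
    fix q assume "q \<in> ?L"
    then have "real (y ^ h) \<le> real q" by (simp del: of_nat_power)
    moreover have "0 < real (y ^ h)" using y by simp
    ultimately show "ln (real (y ^ h)) \<le> ln (real q)" by (metis ln_mono)
  qed
  also have "\<dots> \<le> (\<Sum>q \<in> smooth_upto y M. ln (real q))"
    using fin by (intro sum_mono2) (auto simp: smooth_upto_def)
  also have "\<dots> \<le> 4 * real M * ln (real y)"
    using y by (intro sum_ln_smooth_le) auto
  finally have "real (card ?L) * real h \<le> 4 * real M"
    using lny by (simp flip: mult.assoc)
  then have 1: "real (card ?L) \<le> 4 * real M / real h"
    using h by (simp add: field_simps)
  have "card (smooth_upto y M) \<le> card (?L \<union> {..<y ^ h})"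
    using fin by (intro card_mono) auto
  also have "\<dots> \<le> card ?L + card {..<y ^ h}" by (rule card_Un_le)
  finally have "card (smooth_upto y M) \<le> card ?L + y ^ h" by simp
  then have "real (card (smooth_upto y M)) \<le> real (card ?L) + real y ^ h"
    by (metis of_nat_add of_nat_le_iff of_nat_power)
  then show ?thesis using 1 by linarith
qed

section \<open>Polynomial fingerprints\<close>

text \<open>Lagrange's theorem over Z/p, phrased by divisibility for integer polynomials. A root a
  is divided off; any other root modulo p is a root of the quotient since p is prime.\<close>

lemma card_roots_mod_prime_le:
  fixes f :: "int poly" and p :: int
  assumes p: "prime p" and "\<not> (\<forall>j. p dvd coeff f j)"
  shows "card {x \<in> {0..<p}. p dvd poly f x} \<le> degree f"
  using assms(2)
proof (induction "degree f" arbitrary: f rule: less_induct)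
  case (less f)
  show ?case
  proof (cases "{x \<in> {0..<p}. p dvd poly f x} = {}")
    case False
    then obtain a where a: "a \<in> {0..<p}" "p dvd poly f a" by auto
    define g where "g = synthetic_div f a"
    \<comment> \<open>That is, f(x) = f(a) + (x - a) g(x), with the term a g(x) moved to the
      left.\<close>
    have f: "f + smult a g = pCons (poly f a) g"
      unfolding g_def by (rule synthetic_div_correct)
    have deg: "degree f \<noteq> 0"
    proof
      assume "degree f = 0"
      then obtain c where "f = [:c:]" by (rule degree_eq_zeroE)
      with a have "p dvd coeff f j" for j by (cases j) auto
      with less.prems show False by blast
    qed
    have degg: "degree g = degree f - 1" unfolding g_def by (rule degree_synthetic_div)
    have ndvd: "\<not> (\<forall>j. p dvd coeff g j)"
    proof
      assume *: "\<forall>j. p dvd coeff g j"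
      have "p dvd coeff f j" for j
      proof -
        have "coeff f j + a * coeff g j = coeff (pCons (poly f a) g) j"
          by (metis coeff_add coeff_smult f)
        moreover have "p dvd coeff (pCons (poly f a) g) j"
          using * a by (auto simp: coeff_pCons split: nat.splits)
        ultimately show ?thesis using * by (metis dvd_add_left_iff dvd_mult)
      qed
      with less.prems show False by blast
    qed
    have fin: "finite {x \<in> {0..<p}. p dvd poly g x}"
      by (rule finite_subset[of _ "{0..<p}"]) auto
    have "{x \<in> {0..<p}. p dvd poly f x} \<subseteq> insert a {x \<in> {0..<p}. p dvd poly g x}"
    proof
      fix b assume b: "b \<in> {x \<in> {0..<p}. p dvd poly f x}"
      have "poly f b + a * poly g b = poly f a + b * poly g b"
        using arg_cong[OF f, of "\<lambda>f. poly f b"] by simp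
      then have "(b - a) * poly g b = poly f b - poly f a" by (simp add: algebra_simps)
      then have "p dvd (b - a) * poly g b" using a b by simp
      then have "p dvd b - a \<or> p dvd poly g b" using p by (simp add: prime_dvd_mult_iff)
      moreover have "b = a" if "p dvd b - a"
      proof -
        from that have "b mod p = a mod p" by (simp add: mod_eq_dvd_iff)
        with a b show ?thesis by simp
      qed
      ultimately show "b \<in> insert a {x \<in> {0..<p}. p dvd poly g x}" using b by auto
    qed
    then have "card {x \<in> {0..<p}. p dvd poly f x} \<le> card (insert a {x \<in> {0..<p}. p dvd poly g x})"
      using fin by (intro card_mono) auto
    also have "\<dots> \<le> Suc (card {x \<in> {0..<p}. p dvd poly g x})" by (rule card_insert_le_m1) (auto intro: card_insert_le)
    also have "\<dots> \<le> Suc (degree g)"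
      using less.hyps[of g] degg deg ndvd by simp
    finally show ?thesis using degg deg by simp
  next
    case True
    show ?thesis unfolding True by simp
  qed
qed

text \<open>Horner evaluation at r with the first symbol as leading coefficient. No modulus is built
  in, so the same value can be reduced modulo q and modulo a prime factor of q.\<close>

definition hash :: "nat \<Rightarrow> nat list \<Rightarrow> nat" where
  "hash r xs = foldl (\<lambda>h x. h * r + x) 0 xs"

lemma hash_Nil [simp]: "hash r [] = 0"
  and hash_snoc: "hash r (xs @ [x]) = hash r xs * r + x"
  by (simp_all add: hash_def)

lemma hash_Cons: "hash r (x # xs) = x * r ^ length xs + hash r xs"
  by (induction xs rule: rev_induct)
    (simp_all add: hash_snoc algebra_simps flip: append_Cons, simp add: hash_def)

lemma poly_hash: "poly (Poly (rev (map int xs))) (int r) = int (hash r xs)"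
  by (induction xs rule: rev_induct) (simp_all add: hash_snoc)

text \<open>Collisions are roots modulo p of the difference polynomial. It does not vanish modulo p,
  because different symbols below p differ modulo p.\<close>

lemma card_hash_collisions_prime:
  assumes p: "prime p" and len: "length xs = length ys" and ne: "xs \<noteq> ys"
    and xs: "set xs \<subseteq> {..<p}" and ys: "set ys \<subseteq> {..<p}"
  shows "card {r \<in> {..<p}. hash r xs mod p = hash r ys mod p} \<le> length xs"
proof -
  define f where "f = Poly (rev (map int xs)) - Poly (rev (map int ys))"
  let ?m = "length xs"
  obtain i where i: "i < ?m" "xs ! i \<noteq> ys ! i" using len ne by (metis nth_equalityI)
  have "coeff f (?m - Suc i) = int (xs ! i) - int (ys ! i)"
    using i len by (simp add: f_def coeff_Poly_eq nth_default_nth rev_nth)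
  moreover have "\<not> int p dvd int (xs ! i) - int (ys ! i)"
  proof
    assume "int p dvd int (xs ! i) - int (ys ! i)"
    then have "xs ! i mod p = ys ! i mod p" by (metis mod_eq_dvd_iff of_nat_eq_iff zmod_int)
    moreover have "xs ! i < p" "ys ! i < p"
      using i xs ys len by (metis lessThan_iff nth_mem subsetD)+
    ultimately show False using i by simp
  qed
  ultimately have nd: "\<not> (\<forall>j. int p dvd coeff f j)" by metis
  have deg: "degree f \<le> ?m"
    using len by (intro degree_le) (auto simp: f_def coeff_Poly_eq nth_default_def)
  have "int ` {r \<in> {..<p}. hash r xs mod p = hash r ys mod p} \<subseteq> {x \<in> {0..<int p}. int p dvd poly f x}"
    by (auto simp: f_def poly_hash simp flip: mod_eq_dvd_iff zmod_int)
  then have "card (int ` {r \<in> {..<p}. hash r xs mod p = hash r ys mod p}) \<le> card {x \<in> {0..<int p}. int p dvd poly f x}"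
    by (intro card_mono) (simp_all add: finite_subset[of _ "{0..<int p}"] subset_iff)
  also have "\<dots> \<le> degree f" using p nd by (intro card_roots_mod_prime_le) auto
  finally show ?thesis using deg by (simp add: card_image)
qed

lemma hash_mod_cong: "r mod q = s mod q \<Longrightarrow> hash r xs mod q = hash s xs mod q"
  by (induction xs rule: rev_induct) (auto simp: hash_snoc intro!: mod_add_cong mod_mult_cong)

text \<open>A collision modulo q is one modulo p, and that depends only on \<open>r mod p\<close>.
  So there are \<open>q div p\<close> choices for \<open>r div p\<close> and at most
  \<open>length xs\<close> for \<open>r mod p\<close>.\<close>

lemma card_hash_collisions:
  assumes p: "prime p" and pq: "p dvd q" and len: "length xs = length ys" and ne: "xs \<noteq> ys"
    and xs: "set xs \<subseteq> {..<p}" and ys: "set ys \<subseteq> {..<p}"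
  shows "card {r \<in> {..<q}. hash r xs mod q = hash r ys mod q} \<le> q div p * length xs"
proof -
  let ?C = "{r \<in> {..<p}. hash r xs mod p = hash r ys mod p}"
  have p0: "0 < p" using p by (rule prime_gt_0_nat)
  have inj: "inj_on (\<lambda>r. (r div p, r mod p)) A" for A
    by (rule inj_onI) (metis div_mult_mod_eq prod.inject)
  have "(\<lambda>r. (r div p, r mod p)) ` {r \<in> {..<q}. hash r xs mod q = hash r ys mod q} \<subseteq> {..<q div p} \<times> ?C"
  proof clarsimp
    fix r assume r: "r < q" "hash r xs mod q = hash r ys mod q"
    then have "hash r xs mod p = hash r ys mod p" by (metis pq mod_mod_cancel)
    moreover have "hash (r mod p) zs mod p = hash r zs mod p" for zs by (rule hash_mod_cong) simp
    moreover have "r div p < q div p" using r pq by (metis dvd_mult_div_cancel less_mult_imp_div_less mult.commute)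
    ultimately show "r div p < q div p \<and> r mod p < p \<and> hash (r mod p) xs mod p = hash (r mod p) ys mod p"
      using p0 by simp
  qed
  then have "card ((\<lambda>r. (r div p, r mod p)) ` {r \<in> {..<q}. hash r xs mod q = hash r ys mod q}) \<le> card ({..<q div p} \<times> ?C)"
    by (intro card_mono) auto
  also have "\<dots> \<le> q div p * length xs"
    using card_hash_collisions_prime[OF p len ne xs ys] by (simp add: card_cartesian_product)
  finally show ?thesis using inj by (simp add: card_image)
qed

section \<open>The program\<close>

text \<open>Registers: 1 holds n + 2, 2 the power M = (n + 2)^E, 3 the constant 1, 4 a counter, 5 stays 0,
6 the modulus q, 7 the point r, 8 and 9 the start i and length k of the window, 10 and 11 the
fingerprints of the pattern prefix and of the window, 12 the weight of the first symbol of
the window, 13 to 15 are scratch.  Addresses: 5 power loop, 10 random choices, 14 read a symbol,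
26 compare, 31 slide.\<close>
definition program :: "nat \<Rightarrow> instr list" where
  "program E =
    [Const 1 2, Arith Add 1 0 1, Const 2 1, Const 3 1, Const 4 E,
     Jlt 5 4 7, Goto 10, Arith Mul 2 2 1, Arith Sub 4 4 3, Goto 5,
     Rand 6 2, Arith Add 6 6 3, Rand 7 6, Arith Mod 12 3 6,
     Read 13 45,
     Arith Add 15 8 9, Jlt 15 0 18, Reject,
     Arith Mul 10 10 7, Arith Add 10 10 13, Arith Mod 10 10 6,
     Query 14 15, Arith Mul 11 11 7, Arith Add 11 11 14, Arith Mod 11 11 6,
     Arith Add 9 9 3,
     Jlt 10 11 31, Jlt 11 10 31, Arith Mul 12 12 7, Arith Mod 12 12 6, Goto 14,
     Arith Add 15 8 9, Jlt 15 0 34, Reject,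
     Query 14 8, Arith Mul 14 14 12, Arith Mod 14 14 6, Arith Sub 14 6 14,
     Arith Add 11 11 14, Arith Mul 11 11 7, Query 14 15, Arith Add 11 11 14, Arith Mod 11 11 6,
     Arith Add 8 8 3, Goto 26,
     Accept]"

section \<open>Symbolic execution of the program\<close>

text \<open>The list is named \<open>xs\<close> so that instantiation with
  \<open>program_def\<close> exposes it for the lookup only, while \<open>program E\<close> stays
  folded in the remaining run.\<close>

lemma run_step:
  assumes "program E = xs" "pc < length xs" "0 < f"
  shows "run (program E) T B f pc R S =
    (case xs ! pc of
        Const i v \<Rightarrow>
          (if v < B then run (program E) T B (f - 1) (pc + 1) (R(i := v)) S else return_pmf Fail)
      | Arith op i j l \<Rightarrow>
          (if aop_sem op (R j) (R l) < B
           then run (program E) T B (f - 1) (pc + 1) (R(i := aop_sem op (R j) (R l))) S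
           else return_pmf Fail)
      | Goto t \<Rightarrow> run (program E) T B (f - 1) t R S
      | Jlt j l t \<Rightarrow> (if R j < R l then run (program E) T B (f - 1) t R S
          else run (program E) T B (f - 1) (pc + 1) R S)
      | Query i j \<Rightarrow>
          (let v = (if R j < length T then T ! (R j) else 0) in
           if v < B then run (program E) T B (f - 1) (pc + 1) (R(i := v)) S else return_pmf Fail)
      | Read i t \<Rightarrow>
          (case S of
             [] \<Rightarrow> run (program E) T B (f - 1) t R []
           | x # xs \<Rightarrow> (if x < B then run (program E) T B (f - 1) (pc + 1) (R(i := x)) xs else return_pmf Fail))
      | Rand i j \<Rightarrow>
          bind_pmf (if R j = 0 then return_pmf 0 else pmf_of_set {..<R j})
            (\<lambda>v. if v < B then run (program E) T B (f - 1) (pc + 1) (R(i := v)) S else return_pmf Fail)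
      | Accept \<Rightarrow> return_pmf Acc
      | Reject \<Rightarrow> return_pmf Rej)"
  using assms by (cases f) (simp_all add: Let_def split: instr.split list.split cong: if_cong)

text \<open>With 1 kept as a numeral, addresses and remaining fuel normalize to numerals.\<close>
declare One_nat_def [simp del]

lemmas run_at = run_step[OF program_def]

text \<open>One group of rules per block of the program: rewriting with a group executes that block
  and stops at the first address outside it.\<close>

lemmas run_init =
  run_at[where pc = 0, simplified] run_at[where pc = 1, simplified] run_at[where pc = 2, simplified]
  run_at[where pc = 3, simplified] run_at[where pc = 4, simplified]

lemmas run_pow =
  run_at[where pc = 5, simplified] run_at[where pc = 6, simplified] run_at[where pc = 7, simplified]
  run_at[where pc = 8, simplified] run_at[where pc = 9, simplified]

lemmas run_rand =
  run_at[where pc = 10, simplified] run_at[where pc = 11, simplified] run_at[where pc = 12, simplified]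
  run_at[where pc = 13, simplified]

lemmas run_extend =
  run_at[where pc = 14, simplified] run_at[where pc = 15, simplified] run_at[where pc = 16, simplified]
  run_at[where pc = 17, simplified] run_at[where pc = 18, simplified] run_at[where pc = 19, simplified]
  run_at[where pc = 20, simplified] run_at[where pc = 21, simplified] run_at[where pc = 22, simplified]
  run_at[where pc = 23, simplified] run_at[where pc = 24, simplified] run_at[where pc = 25, simplified]
  run_at[where pc = 45, simplified]

lemmas run_test =
  run_at[where pc = 26, simplified] run_at[where pc = 27, simplified]

lemmas run_match =
  run_at[where pc = 28, simplified] run_at[where pc = 29, simplified] run_at[where pc = 30, simplified]

lemmas run_slide =
  run_at[where pc = 31, simplified] run_at[where pc = 32, simplified] run_at[where pc = 33, simplified]
  run_at[where pc = 34, simplified] run_at[where pc = 35, simplified] run_at[where pc = 36, simplified]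
  run_at[where pc = 37, simplified] run_at[where pc = 38, simplified] run_at[where pc = 39, simplified]
  run_at[where pc = 40, simplified] run_at[where pc = 41, simplified] run_at[where pc = 42, simplified]
  run_at[where pc = 43, simplified] run_at[where pc = 44, simplified]

section \<open>Correctness for a fixed modulus and evaluation point\<close>

text \<open>Removes the outgoing symbol from a fingerprint: adding q - a mod q replaces a
  subtraction that would truncate on naturals.\<close>

lemma mod_cancel_left: "0 < (q :: nat) \<Longrightarrow> ((a + b) mod q + (q - a mod q)) mod q = b mod q"
proof -
  assume "0 < q"
  then have "a mod q + b + (q - a mod q) = b + q" by simp
  moreover have "((a + b) mod q + (q - a mod q)) mod q = (a mod q + b + (q - a mod q)) mod q"
    by (simp add: mod_simps add.assoc) 
  ultimately show ?thesis by simp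
qed

lemma mod_horner: "(a mod q * r + x) mod q = (a * r + x) mod (q :: nat)"
  by (metis mod_add_left_eq mod_mult_left_eq)

text \<open>Once q and r are chosen the run is deterministic. In the bound on B, 2 * q * q covers
  the unreduced product in a slide, \<sigma> * q a symbol times the weight, and the rest symbols and
  indices.\<close>

locale rabin_karp =
  fixes E \<sigma> :: nat and T P :: "nat list" and B q r :: nat
  assumes T: "set T \<subseteq> {..<\<sigma>}" and P: "set P \<subseteq> {..<\<sigma>}"
    and r: "r < q" and B: "2 * q * q + \<sigma> * q + \<sigma> + length T + 2 \<le> B"
begin

definition window :: "nat \<Rightarrow> nat \<Rightarrow> nat list" where
  "window i k = take k (drop i T)"

text \<open>One-sided: acceptance only asserts a fingerprint match somewhere, whereas rejection
  asserts true absence. A pattern that occurs is therefore accepted with certainty.\<close>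

definition correct :: "result pmf \<Rightarrow> bool" where
  "correct \<mu> \<longleftrightarrow>
    \<mu> = return_pmf Acc \<and>
      (\<exists>i. i + length P \<le> length T \<and> hash r (window i (length P)) mod q = hash r P mod q) \<or>
    \<mu> = return_pmf Rej \<and> \<not> sublist P T"

text \<open>The values \<open>a\<close>, \<open>b\<close>, \<open>w\<close> are passed unreduced, so
  that the invariants can speak of exact fingerprints and powers of r.\<close>

definition state :: "(nat \<Rightarrow> nat) \<Rightarrow> nat \<Rightarrow> nat \<Rightarrow> nat \<Rightarrow> nat \<Rightarrow> nat \<Rightarrow> bool" where
  "state R i k a b w \<longleftrightarrow> R 0 = length T \<and> R 3 = 1 \<and> R 6 = q \<and> R 7 = r \<and>
    R 8 = i \<and> R 9 = k \<and> R 10 = a mod q \<and> R 11 = b mod q \<and> R 12 = w mod q"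

definition excluded :: "nat \<Rightarrow> bool" where
  "excluded i \<longleftrightarrow> (\<forall>j<i. window j (length P) \<noteq> P)"

lemma q_pos: "0 < q" using r by simp

lemma window_Suc: "i + k < length T \<Longrightarrow> window i (Suc k) = window i k @ [T ! (i + k)]"
  by (simp add: window_def take_Suc_conv_app_nth)

lemma window_Cons: "i < length T \<Longrightarrow> window i (Suc k) = T ! i # window (Suc i) k"
  by (simp add: window_def flip: Cons_nth_drop_Suc)

lemma length_window: "i + k \<le> length T \<Longrightarrow> length (window i k) = k"
  by (simp add: window_def)

lemma not_sublist:
  assumes "excluded i" "length T < i + length P"
  shows "\<not> sublist P T"
proof
  assume "sublist P T"
  then obtain us vs where T': "T = us @ P @ vs" by (auto simp: sublist_def)
  then have "window (length us) (length P) = P" unfolding window_def by (simp add: T')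
  moreover have "length us < i" using assms(2) T' by simp
  ultimately show False using assms(1) by (auto simp: excluded_def)
qed

text \<open>A mismatch of the prefix read so far rules out this start for the whole pattern,
  whatever the unread symbols are; hence the window never moves back.\<close>

lemma excluded_Suc:
  assumes "excluded i" and Q: "P = Q @ S" and "hash r Q mod q \<noteq> hash r (window i (length Q)) mod q"
  shows "excluded (Suc i)"
proof -
  have "window i (length P) \<noteq> P"
  proof
    assume "window i (length P) = P"
    then have "take (length Q) (window i (length P)) = Q" using Q by simp
    then have "window i (length Q) = Q" using Q by (simp add: window_def min_def)
    with assms(3) show False by simp
  qed
  with assms(1) show ?thesis by (auto simp: excluded_def less_Suc_eq)
qed

lemma T_less: "i < length T \<Longrightarrow> T ! i < \<sigma>"
  using T nth_mem by blast

lemma mod_mult_bound: "a mod q * b < B" if "b \<le> q"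
proof -
  have "a mod q * b \<le> q * q" using q_pos that by (intro mult_le_mono) (auto simp: less_imp_le)
  then show ?thesis using B by linarith
qed

lemma symbol_bound: "x < \<sigma> \<Longrightarrow> x < B" using B by linarith

lemma mod_mult_add_bound: "a mod q * r + x < B" if "x < \<sigma>"
proof -
  have "a mod q * r \<le> q * q" using q_pos r by (intro mult_le_mono) (auto simp: less_imp_le)
  then show ?thesis using B that by linarith
qed

lemma mod_bound: "a mod q < B"
proof -
  have "a mod q < q" using q_pos by simp
  moreover have "q \<le> q * q" by simp
  ultimately show ?thesis using B by linarith
qed

text \<open>The factor 2 arises because the sum with the negated outgoing term is not reduced before
  the multiplication by r.\<close>

lemma sum_bound: "a mod q + (q - c) < B"  "(a mod q + (q - c)) * r < B"
  "x < \<sigma> \<Longrightarrow> (a mod q + (q - c)) * r + x < B"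
proof -
  have aq: "a mod q + (q - c) \<le> 2 * q" using q_pos by (simp add: less_imp_le add_mono mult_2)
  have "q \<le> q * q" by simp
  with aq show "a mod q + (q - c) < B" using B by linarith
  have "(a mod q + (q - c)) * r \<le> 2 * q * q" using r aq by (intro mult_le_mono) auto
  then show "(a mod q + (q - c)) * r < B"  "x < \<sigma> \<Longrightarrow> (a mod q + (q - c)) * r + x < B" using B by linarith+
qed

lemma symbol_mult_bound: "x * (a mod q) < B" if "x < \<sigma>"
proof -
  have "x * (a mod q) \<le> \<sigma> * q" using q_pos that by (intro mult_le_mono) (auto simp: less_imp_le)
  then show ?thesis using B by linarith
qed

text \<open>The inner loop, by induction on the room left for shifts. \<open>head\<close> describes
  the continuation once the fingerprints agree, and F is its fuel apart from 20 per shift. The first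
  symbol of a window of length \<open>Suc k\<close> has weight r ^ k; on leaving the loop it is
  raised to r ^ \<open>Suc k\<close>, ready for the next symbol.\<close>

lemma correct_slide:
  assumes head: "\<And>f R i. state R i (Suc k) (hash r Q) (hash r (window i (Suc k))) (r ^ Suc k) \<Longrightarrow>
       hash r Q mod q = hash r (window i (Suc k)) mod q \<Longrightarrow> excluded i \<Longrightarrow>
       i + Suc k \<le> length T \<Longrightarrow> F + 20 * (length T - i) \<le> f \<Longrightarrow>
       correct (run (program E) T B f 14 R S)"
    and Q: "P = Q @ S" "length Q = Suc k"
    and "state R i (Suc k) (hash r Q) (hash r (window i (Suc k))) (r ^ k)"
    and "excluded i" "i + Suc k \<le> length T" "F + 10 + 20 * (length T - i) \<le> f"
  shows "correct (run (program E) T B f 26 R S)"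
  using assms(4-)
proof (induction "length T - i" arbitrary: i R f rule: less_induct)
  case less
  have R: "R 0 = length T" "R 3 = 1" "R 6 = q" "R 7 = r" "R 8 = i" "R 9 = Suc k"
    "R 10 = hash r Q mod q" "R 11 = hash r (window i (Suc k)) mod q" "R 12 = r ^ k mod q"
    using less.prems(1) by (auto simp: state_def)
  have f: "10 \<le> f" using less.prems by linarith
  show ?case
  proof (cases "hash r Q mod q = hash r (window i (Suc k)) mod q")
    case True
    have "run (program E) T B f 26 R S = run (program E) T B (f - 5) 14 (R(12 := r ^ k * r mod q)) S"
      using f True by (simp add: run_test run_match R mod_mult_bound mod_bound r less_imp_le mod_mult_left_eq)
    also have "correct \<dots>"
      using less.prems True R by (intro head[of _ i]) (auto simp: state_def mult.commute)
    finally show ?thesis .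
  next
    case False
    then have ex: "excluded (Suc i)" using less.prems Q by (intro excluded_Suc) auto
    have step: "run (program E) T B f 26 R S = run (program E) T B (f - (if hash r Q mod q < hash r (window i (Suc k)) mod q then 1 else 2)) 31 R S"
      using f False by (auto simp: run_test R)
    \<comment> \<open>Inequality is tested by two strict comparisons, so reaching the slide costs
      one or two steps; f' covers both cases.\<close>
    obtain f' where f': "run (program E) T B f 26 R S = run (program E) T B f' 31 R S" "f \<le> f' + 2"
      by (rule that[OF step]) (cases "hash r Q mod q < hash r (window i (Suc k)) mod q"; simp; linarith)
    have f8: "8 \<le> f'" using f f' by linarith
    show ?thesis
    proof (cases "i + Suc k < length T")
      case False
      with f8 have "run (program E) T B f' 31 R S = return_pmf Rej"
        using less.prems(3) B by (simp add: run_slide R)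
      \<comment> \<open>The window touches the end of the text and the pattern is at least as long,
        so no later start leaves room for it.\<close>
      moreover have "\<not> sublist P T" using ex False Q by (intro not_sublist[of "Suc i"]) auto
      ultimately show ?thesis using f' by (simp add: correct_def)
    next
      case True
      have f16: "20 \<le> f'" using True less.prems f' by linarith
      \<comment> \<open>Rolling update: drop the outgoing symbol with weight r ^ k, then do one
        Horner step with the incoming one.\<close>
      have win: "hash r (window (Suc i) (Suc k)) mod q =
         ((hash r (window i (Suc k)) mod q + (q - T ! i * (r ^ k mod q) mod q)) * r + T ! (i + Suc k)) mod q"
      proof -
        have "(hash r (window i (Suc k)) mod q + (q - T ! i * (r ^ k mod q) mod q)) mod q = hash r (window (Suc i) k) mod q"
          using True mod_cancel_left[OF q_pos, of "T ! i * r ^ k" "hash r (window (Suc i) k)"]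
          by (simp add: window_Cons hash_Cons length_window mod_mult_right_eq)
        moreover have "hash r (window (Suc i) (Suc k)) = hash r (window (Suc i) k) * r + T ! (i + Suc k)"
          using True by (simp add: window_Suc hash_snoc)
        ultimately show ?thesis by (metis mod_add_cong mod_mult_cong)
      qed
      have len: "i < length T" "Suc (i + k) < length T" using True by auto
      let ?c = "(T ! i * (r ^ k mod q)) mod q"
      have small: "i + 1 < B" "i + Suc k < B" "q - ?c < B" using len B mod_bound sum_bound(1)[of 0 ?c] by auto
      \<comment> \<open>A slide takes 13 steps after at most 2 for the comparison, within the 20
        reserved per shift.\<close>
      have slide: "correct (run (program E) T B (f' - 13) 26 R' S)"
        if "state R' (Suc i) (Suc k) (hash r Q) (hash r (window (Suc i) (Suc k))) (r ^ k)" for R'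
        using less.prems len f' True ex that by (intro less.hyps[of "Suc i"]) auto
      have "correct (run (program E) T B f' 31 R S)"
        using f16 len small r
        apply (simp add: run_slide R Let_def symbol_bound T_less symbol_mult_bound mod_bound sum_bound del: Nat.add_diff_assoc)
        apply (rule slide)
        apply (simp add: state_def win R del: Nat.add_diff_assoc)
        done
      then show ?thesis using f' by simp
    qed
  qed
qed

text \<open>The outer loop, by induction on the unread stream. The fuel acts as a potential: 30 per
  unread symbol and 20 per remaining shift. One symbol may cause many slides, but the total stays
  linear.\<close>

lemma correct_extend:
  assumes "P = Q @ S" "length Q = k"
    and "state R i k (hash r Q) (hash r (window i k)) (r ^ k)"
    and "hash r Q mod q = hash r (window i k) mod q"
    and "excluded i" "i + k \<le> length T" "5 + 30 * length S + 20 * (length T - i) \<le> f"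
  shows "correct (run (program E) T B f 14 R S)"
  using assms
proof (induction S arbitrary: Q k i R f)
  case Nil
  have "run (program E) T B f 14 R [] = return_pmf Acc"
    using Nil.prems by (simp add: run_extend)
  moreover have Q: "Q = P" "length P = k" using Nil.prems(1,2) by simp_all
  moreover have "\<exists>i. i + length P \<le> length T \<and> hash r (window i (length P)) mod q = hash r P mod q"
    using Nil.prems(4,6) unfolding Q by (intro exI[of _ i]) simp
  ultimately show ?case by (simp add: correct_def)
next
  case (Cons x S)
  have R: "R 0 = length T" "R 3 = 1" "R 6 = q" "R 7 = r" "R 8 = i" "R 9 = k"
    "R 10 = hash r Q mod q" "R 11 = hash r (window i k) mod q" "R 12 = r ^ k mod q"
    using Cons.prems(3) by (auto simp: state_def)
  have f: "30 \<le> f" using Cons.prems by simp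
  have x: "x < \<sigma>" using P Cons.prems by auto
  show ?case
  proof (cases "i + k < length T")
    case False
    with f x have "run (program E) T B f 14 R (x # S) = return_pmf Rej"
      using Cons.prems(6) B by (simp add: run_extend R)
    moreover have "\<not> sublist P T" using Cons.prems False by (intro not_sublist[of i]) auto
    ultimately show ?thesis by (simp add: correct_def)
  next
    case True
    have small: "i + k < B" "k + 1 < B" using True B by auto
    \<comment> \<open>Reading a symbol and extending both fingerprints takes 11 steps. The weight
      register still holds r ^ k, which is the weight of the first symbol of the longer
      window.\<close>
    have extend: "correct (run (program E) T B (f - 11) 26 R' S)"
      if "state R' i (Suc k) (hash r (Q @ [x])) (hash r (window i (Suc k))) (r ^ k)" for R'
    proof (rule correct_slide[where Q = "Q @ [x]" and F = "5 + 30 * length S"])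
      fix f R i
      assume "state R i (Suc k) (hash r (Q @ [x])) (hash r (window i (Suc k))) (r ^ Suc k)"
        "hash r (Q @ [x]) mod q = hash r (window i (Suc k)) mod q" "excluded i"
        "i + Suc k \<le> length T" "5 + 30 * length S + 20 * (length T - i) \<le> f"
      then show "correct (run (program E) T B f 14 R S)"
        using Cons.prems(1,2) by (intro Cons.IH[of "Q @ [x]" "Suc k"]) simp_all
    next
      show "P = (Q @ [x]) @ S" using Cons.prems(1) by simp
      show "5 + 30 * length S + 10 + 20 * (length T - i) \<le> f - 11" using Cons.prems(7) by simp
    next
      show "length (Q @ [x]) = Suc k" using Cons.prems(2) by simp
      show "excluded i" by (rule Cons.prems(5))
      show "i + Suc k \<le> length T" using True by simp
      show "state R' i (Suc k) (hash r (Q @ [x])) (hash r (window i (Suc k))) (r ^ k)" by (rule that)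
    qed
    show ?thesis
      using f x True small
      apply (simp add: run_extend R Let_def symbol_bound T_less mod_mult_bound mod_bound mod_mult_add_bound r less_imp_le)
      apply (rule extend)
      apply (simp add: state_def R hash_snoc window_Suc mod_horner)
      done
  qed
qed

end

section \<open>Initialization, word size and random choices\<close>

text \<open>An iteration takes 4 steps and the exit 2. The initial counter value E is fixed in the
  program, so the loop costs constant time.\<close>

lemma run_power:
  assumes "R 1 = N" "R 3 = 1" "R 5 = 0" "R 4 = j" "0 < N" "R 2 * N ^ j < B" "j < B" "5 * j + 3 \<le> f"
  obtains R' f' where "run (program E) T B f 5 R S = run (program E) T B f' 10 R' S"
    "f \<le> f' + 5 * j + 2" "R' 2 = R 2 * N ^ j" "\<And>l. l \<notin> {2, 4} \<Longrightarrow> R' l = R l"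
  using assms
proof (induction j arbitrary: R f thesis)
  case 0
  have "run (program E) T B f 5 R S = run (program E) T B (f - 2) 10 R S"
    using 0 by (simp add: run_pow)
  then show ?case using 0(1)[of "f - 2" R] by simp
next
  case (Suc j)
  let ?R = "R(2 := R 2 * N, 4 := j)"
  have "R 2 * N * N ^ j < B" using Suc.prems by (simp add: mult.assoc)
  \<comment> \<open>Partial products are at most the final one, so the word bound on the result
    covers them.\<close>
  moreover have "R 2 * N * 1 \<le> R 2 * N * N ^ j"
    using Suc.prems by (intro mult_le_mono) auto
  ultimately have b: "R 2 * N < B" by linarith
  have step: "run (program E) T B f 5 R S = run (program E) T B (f - 4) 5 ?R S"
    using Suc.prems b by (simp add: run_pow)
  obtain R' f' where *: "run (program E) T B (f - 4) 5 ?R S = run (program E) T B f' 10 R' S"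
    "f - 4 \<le> f' + 5 * j + 2" "R' 2 = ?R 2 * N ^ j" "\<And>l. l \<notin> {2, 4} \<Longrightarrow> R' l = ?R l"
    by (rule Suc.IH[where R = ?R and f = "f - 4"]) (use Suc.prems in \<open>auto simp: mult.assoc\<close>)
  show ?case
    by (rule Suc.prems(1)[of f' R']) (use step * in auto)
qed

text \<open>Constants are absorbed into powers of N \<ge> 2, as in \<sigma> < 2 ^ \<sigma> \<le> N ^
  \<sigma>. The four summands are at most \<open>?X\<close> each, and 4 \<open>?X\<close> \<le> N ^
  2 \<open>?X\<close>.\<close>

lemma word_bound:
  fixes N \<sigma> E c q :: nat
  assumes N: "2 \<le> N" and c: "2 * E + \<sigma> + 4 \<le> c" and q: "q \<le> N ^ E"
  shows "2 * q * q + \<sigma> * q + \<sigma> + N \<le> N ^ c" "N ^ E < N ^ c" "E < N ^ c" "N < N ^ c" "1 < N ^ c"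
proof -
  let ?X = "N ^ (2 * E + \<sigma> + 1)"
  have N1: "1 \<le> N ^ l" for l using N by simp
  have "\<sigma> < 2 ^ \<sigma>" by simp
  also have "(2::nat) ^ \<sigma> \<le> N ^ \<sigma>" using assms by (intro power_mono) auto
  finally have s: "\<sigma> \<le> N ^ \<sigma>" by simp
  have "2 * q * q \<le> N * N ^ E * N ^ E" using N q by (intro mult_le_mono) auto
  also have "\<dots> = N ^ (2 * E + 1)" by (simp add: power_add mult_2)
  also have "\<dots> \<le> ?X" using N by (intro power_increasing) auto
  finally have 1: "2 * q * q \<le> ?X" .
  have "\<sigma> * q \<le> N ^ \<sigma> * N ^ E" using s q by (intro mult_le_mono)
  also have "\<dots> = N ^ (\<sigma> + E)" by (simp add: power_add)
  also have "\<dots> \<le> ?X" using N by (intro power_increasing) auto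
  finally have 2: "\<sigma> * q \<le> ?X" .
  have "N ^ \<sigma> \<le> ?X" using N by (intro power_increasing) auto
  with s have 3: "\<sigma> \<le> ?X" by linarith
  have "N ^ 1 \<le> ?X" using N by (intro power_increasing) auto
  then have 4: "N \<le> ?X" by simp
  have "2 * q * q + \<sigma> * q + \<sigma> + N \<le> 2 ^ 2 * ?X" using 1 2 3 4 by simp
  also have "\<dots> \<le> N ^ 2 * ?X" using N by (intro mult_le_mono power_mono) auto
  also have "\<dots> = N ^ (2 * E + \<sigma> + 3)" by (simp add: numeral_eq_Suc power_add)
  also have "\<dots> \<le> N ^ c" using N c by (intro power_increasing) auto
  finally show "2 * q * q + \<sigma> * q + \<sigma> + N \<le> N ^ c" .
  show NE: "N ^ E < N ^ c" using N c by (intro power_strict_increasing) auto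
  have "E < 2 ^ E" by simp
  also have "(2::nat) ^ E \<le> N ^ E" using N by (intro power_mono) auto
  finally show "E < N ^ c" using NE by linarith
  have "N ^ 1 < N ^ c" using N c by (intro power_strict_increasing) auto
  then show "N < N ^ c" by simp
  then show "1 < N ^ c" using N by linarith
qed

text \<open>Separates the randomness from the deterministic rest \<open>g v r\<close>. The random
  number v starts at 0, so the modulus is q = v + 1, uniform in {1..M}.\<close>

lemma outcome_program:
  fixes T P :: "nat list"
  defines "n \<equiv> length T" and "m \<equiv> length P"
  assumes T: "set T \<subseteq> {..<\<sigma>}" and P: "set P \<subseteq> {..<\<sigma>}"
    and c: "5 * E + \<sigma> + 100 \<le> c"
  obtains g where
    "outcome (program E) T P ((n + 2) ^ c) (c * (n + m + 1)) =
      pmf_of_set {..<(n + 2) ^ E} \<bind> (\<lambda>v. pmf_of_set {..<v + 1} \<bind> g v)"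
    "\<And>v r. v < (n + 2) ^ E \<Longrightarrow> r < v + 1 \<Longrightarrow>
        g v r = return_pmf Acc \<and>
        (\<exists>i. i + m \<le> n \<and> hash r (take m (drop i T)) mod (v + 1) = hash r P mod (v + 1)) \<or>
        g v r = return_pmf Rej \<and> \<not> sublist P T"
proof -
  let ?N = "n + 2"
  let ?B = "?N ^ c"
  let ?run = "run (program E) T ?B"
  let ?M = "?N ^ E"
  have N: "2 \<le> ?N" by simp
  have c': "2 * E + \<sigma> + 4 \<le> c" using c by linarith
  note small = word_bound(2-5)[OF N c' order_refl]
  have "c * (n + m + 1) = c * (n + m) + c" by (simp add: algebra_simps)
  moreover have "100 * (n + m) \<le> c * (n + m)" using c by (intro mult_le_mono1) simp
  ultimately have fuel: "5 * E + 100 + 100 * (n + m) \<le> c * (n + m + 1)" using c by linarith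
  define f where "f = c * (n + m + 1)"
  define R0 :: "nat \<Rightarrow> nat" where "R0 = (\<lambda>_. 0)(0 := n, 1 := n + 2, 2 := 1, 3 := 1, 4 := E)"
  have "outcome (program E) T P ?B f = ?run (f - 5) 5 R0 P"
    using small fuel unfolding outcome_def f_def[symmetric]
    by (simp add: run_init R0_def n_def fun_upd_twist)
  moreover obtain R f' where R: "?run (f - 5) 5 R0 P = ?run f' 10 R P"
    "f - 5 \<le> f' + 5 * E + 2" "R 2 = R0 2 * ?N ^ E" "\<And>l. l \<notin> {2, 4} \<Longrightarrow> R l = R0 l"
    by (rule run_power[of R0 ?N E ?B "f - 5" E T P]) (use small fuel in \<open>auto simp: R0_def f_def\<close>)
  have f': "80 + 30 * m + 20 * n \<le> f'" using R(2) fuel by (simp add: f_def)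
  have regs: "R 0 = n" "R 2 = ?M" "R 3 = 1" "R 8 = 0" "R 9 = 0" "R 10 = 0" "R 11 = 0"
    using R(3,4) by (simp_all add: R0_def)
  \<comment> \<open>Four steps choose q and r and set the weight. The empty window has weight r ^ 0
    = 1, reduced because it becomes 0 when q = 1.\<close>
  define g where "g v r = ?run (f' - 4) 14 (R(6 := v + 1, 7 := r, 12 := 1 mod (v + 1))) P" for v r
  have M0: "?M \<noteq> 0" by simp
  have "?run f' 10 R P = pmf_of_set {..<?M} \<bind> (\<lambda>v. pmf_of_set {..<v + 1} \<bind> g v)"
  proof -
    have "?run f' 10 R P = pmf_of_set {..<?M} \<bind> (\<lambda>v. if v < ?B then ?run (f' - 1) 11 (R(6 := v)) P else return_pmf Fail)"
      using f' by (simp add: run_rand(1) regs cong: if_cong)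
    also have "\<dots> = pmf_of_set {..<?M} \<bind> (\<lambda>v. pmf_of_set {..<v + 1} \<bind> g v)"
    proof (rule bind_pmf_cong[OF refl])
      fix v assume "v \<in> set_pmf (pmf_of_set {..<?M})"
      then have v: "v < ?M" using M0 by (subst (asm) set_pmf_of_set) (auto simp: lessThan_empty_iff)
      then have vB: "v < ?B" "v + 1 < ?B" using small by linarith+
      have "?run (f' - 1) 11 (R(6 := v)) P = pmf_of_set {..<v + 1} \<bind>
         (\<lambda>r. if r < ?B then ?run (f' - 3) 13 (R(6 := v + 1, 7 := r)) P else return_pmf Fail)"
        using f' vB by (simp add: run_rand(2) run_rand(3) regs cong: if_cong)
      also have "\<dots> = pmf_of_set {..<v + 1} \<bind> g v"
      proof (rule bind_pmf_cong[OF refl])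
        fix r assume "r \<in> set_pmf (pmf_of_set {..<v + 1})"
        then have r: "r < v + 1" by (subst (asm) set_pmf_of_set) (auto simp: lessThan_empty_iff)
        have "1 mod (v + 1) \<le> 1" by (rule mod_less_eq_dividend)
        then have "1 mod (v + 1) < ?B" using small by linarith
        then show "(if r < ?B then ?run (f' - 3) 13 (R(6 := v + 1, 7 := r)) P else return_pmf Fail) = g v r"
          using r vB f' by (simp add: run_rand(4) regs g_def)
      qed
      finally show "(if v < ?B then ?run (f' - 1) 11 (R(6 := v)) P else return_pmf Fail) = pmf_of_set {..<v + 1} \<bind> g v"
        using vB by simp
    qed
    finally show ?thesis .
  qed
  moreover have "g v r = return_pmf Acc \<and>
        (\<exists>i. i + m \<le> n \<and> hash r (take m (drop i T)) mod (v + 1) = hash r P mod (v + 1)) \<or>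
        g v r = return_pmf Rej \<and> \<not> sublist P T"
    if v: "v < ?M" and r: "r < v + 1" for v r
  proof -
    interpret rabin_karp E \<sigma> T P ?B "v + 1" r
    proof
      have "v + 1 \<le> ?M" using v by linarith
      from word_bound(1)[OF N c' this]
      show "2 * (v + 1) * (v + 1) + \<sigma> * (v + 1) + \<sigma> + length T + 2 \<le> ?B"
        by (simp only: n_def add.assoc)
    qed (use T P r in auto)
    have "correct (g v r)" unfolding g_def
      by (rule correct_extend[of "[]" _ 0 _ 0])
        (use f' in \<open>simp_all add: state_def regs window_def excluded_def n_def[symmetric] m_def[symmetric]\<close>)
    then show ?thesis by (simp only: correct_def window_def n_def m_def)
  qed
  ultimately show ?thesis using R(1) that f_def by simp
qed

declare One_nat_def [simp]

section \<open>Error probability\<close>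

text \<open>Union bound over at most n + 1 starts, using a prime factor p > y of q. Each start has
  at most \<open>q div p * m\<close> bad points, and p > k (n + 1) n brings the total down to q / k.
  Since p > \<sigma>, the symbols stay distinct modulo p.\<close>

lemma card_collisions_le:
  fixes T P :: "nat list"
  defines "n \<equiv> length T" and "m \<equiv> length P"
  assumes T: "set T \<subseteq> {..<\<sigma>}" and P: "set P \<subseteq> {..<\<sigma>}" and ns: "\<not> sublist P T"
    and y: "\<sigma> \<le> y" "k * (n + 1) * n \<le> y" and q: "q \<in> {1..M}" "q \<notin> smooth_upto y M"
  shows "k * card {r \<in> {..<q}. \<exists>i. i + m \<le> n \<and> hash r (take m (drop i T)) mod q = hash r P mod q} \<le> q"
proof (cases "m \<le> n")
  case True
  let ?C = "\<lambda>i. {r \<in> {..<q}. hash r (take m (drop i T)) mod q = hash r P mod q}"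
  obtain p where p: "prime p" "p dvd q" "y < p"
    using q by (auto simp: smooth_upto_def not_le)
  have "{r \<in> {..<q}. \<exists>i. i + m \<le> n \<and> hash r (take m (drop i T)) mod q = hash r P mod q}
      = (\<Union>i\<in>{..n - m}. ?C i)"
    using True by (auto simp: le_diff_conv2)
  also have "card \<dots> \<le> (\<Sum>i\<in>{..n - m}. card (?C i))"
    by (rule card_UN_le) simp
  also have "\<dots> \<le> (\<Sum>i\<in>{..n - m}. q div p * m)"
  proof (rule sum_mono)
    fix i assume i: "i \<in> {..n - m}"
    let ?w = "take m (drop i T)"
    have len: "length ?w = m" using i True by (auto simp: n_def)
    have "sublist ?w T" by (meson sublist_drop sublist_order.order_trans sublist_take)
    then have "?w \<noteq> P" using ns by auto
    moreover have "set ?w \<subseteq> {..<p}"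
    proof -
      have "set ?w \<subseteq> set T" by (meson order.trans set_drop_subset set_take_subset)
      also have "\<dots> \<subseteq> {..<p}" using T y(1) p(3) by (auto simp: subset_iff)
      finally show ?thesis .
    qed
    moreover have "set P \<subseteq> {..<p}" using P y(1) p(3) by (auto simp: subset_iff)
    ultimately show "card (?C i) \<le> q div p * m"
      using card_hash_collisions[OF p(1,2), of ?w P] len by (simp add: m_def)
  qed
  also have "\<dots> = (n - m + 1) * (q div p * m)" by (simp add: distrib_right)
  also have "\<dots> \<le> (n + 1) * (q div p * n)"
    using True by (intro mult_le_mono) auto
  finally have "k * card {r \<in> {..<q}. \<exists>i. i + m \<le> n \<and> hash r (take m (drop i T)) mod q = hash r P mod q}
     \<le> k * ((n + 1) * (q div p * n))" by (rule mult_le_mono2)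
  also have "\<dots> = (k * (n + 1) * n) * (q div p)" by (simp only: mult_ac)
  also have "\<dots> \<le> p * (q div p)" using y p by (intro mult_le_mono1) simp
  also have "\<dots> \<le> q" by simp
  finally show ?thesis .
next
  case False
  then show ?thesis by simp
qed

text \<open>The exponent of y is made of 8 for 256 = 2 ^ 8, 2 for N ^ 2, and \<sigma> for the
  alphabet size.\<close>

lemma parameter_bounds:
  fixes N \<sigma> a y :: nat
  assumes "2 \<le> N" and a: "a = 10 + \<sigma>" and y: "y = N ^ a"
  shows "\<sigma> \<le> y" "256 * N ^ 2 \<le> y" "1024 \<le> y"
proof -
  have "\<sigma> < 2 ^ \<sigma>" by simp
  also have "(2::nat) ^ \<sigma> \<le> N ^ \<sigma>" using assms by (intro power_mono) auto
  finally have s: "\<sigma> \<le> N ^ \<sigma>" by simp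
  have N1: "1 \<le> N ^ l" for l using assms by simp
  have "(2::nat) ^ 8 \<le> N ^ 8" using assms by (intro power_mono) auto
  then have "256 * N ^ 2 * 1 \<le> N ^ 8 * N ^ 2 * N ^ \<sigma>" using N1 by (intro mult_le_mono) auto
  then show "256 * N ^ 2 \<le> y" by (simp add: y a power_add flip: power_add)
  have "1 * \<sigma> \<le> N ^ 10 * N ^ \<sigma>" using s N1 by (intro mult_le_mono) auto
  then show "\<sigma> \<le> y" by (simp add: y a power_add)
  have "(2::nat) ^ 10 \<le> N ^ 10" using assms by (intro power_mono) auto
  then have "1024 * 1 \<le> N ^ 10 * N ^ \<sigma>" using N1 by (intro mult_le_mono) auto
  then show "1024 \<le> y" by (simp add: y a power_add)
qed

text \<open>Here X collects the bad moduli, for which the acceptance probability is bounded by 1;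
  for the others it is at most 1 / k. Averaging over v bounds acceptance, and all remaining mass
  lies on \<open>Rej\<close>.\<close>

lemma pmf_two_stage:
  fixes g :: "nat \<Rightarrow> nat \<Rightarrow> result pmf" and M k :: nat
  defines "res \<equiv> pmf_of_set {..<M} \<bind> (\<lambda>v. pmf_of_set {..<v + 1} \<bind> g v)"
  assumes M: "0 < M"
    and g: "\<And>v r. v < M \<Longrightarrow> r < v + 1 \<Longrightarrow> g v r \<in> {return_pmf Acc, return_pmf Rej}"
    and few: "\<And>v. v < M \<Longrightarrow> v + 1 \<notin> X \<Longrightarrow> k * card {r \<in> {..<v + 1}. g v r = return_pmf Acc} \<le> v + 1"
    and X: "finite X" and k: "0 < k"
  shows "pmf res Fail = 0" "pmf res Rej \<ge> 1 - (card X / M + 1 / k)"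
proof -
  have ne: "{..<M} \<noteq> {}" "\<And>v::nat. {..<v + 1} \<noteq> {}" using M by (auto simp: lessThan_empty_iff)
  have set: "set_pmf res \<subseteq> {Acc, Rej}"
  proof
    fix x assume "x \<in> set_pmf res"
    then obtain v r where "v < M" "r < v + 1" and x: "x \<in> set_pmf (g v r)"
      using ne by (auto simp: res_def set_pmf_of_set)
    with g[of v r] show "x \<in> {Acc, Rej}" by auto
  qed
  then have "Fail \<notin> set_pmf res" by blast
  then show "pmf res Fail = 0" by (simp add: pmf_eq_0_set_pmf)
  have inner: "pmf (pmf_of_set {..<v + 1} \<bind> g v) Acc \<le> indicator X (v + 1) + 1 / k" if v: "v < M" for v
  proof (cases "v + 1 \<in> X")
    case True
    then show ?thesis using pmf_le_1[of "pmf_of_set {..<v + 1} \<bind> g v" Acc] by (simp add: add_increasing2)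
  next
    case False
    have "pmf (pmf_of_set {..<v + 1} \<bind> g v) Acc = (\<Sum>r<v + 1. pmf (g v r) Acc) / card {..<v + 1}"
      using ne by (intro pmf_bind_pmf_of_set) auto
    also have "(\<Sum>r<v + 1. pmf (g v r) Acc) = (\<Sum>r<v + 1. if g v r = return_pmf Acc then 1 else 0)"
      using g[OF v] by (intro sum.cong refl) (force simp: indicator_def)
    also have "\<dots> = card {r \<in> {..<v + 1}. g v r = return_pmf Acc}"
      by (simp add: sum.If_cases Int_def del: sum.lessThan_Suc)
    also have "\<dots> / card {..<v + 1} \<le> 1 / k"
    proof -
      have "real k * real (card {r \<in> {..<v + 1}. g v r = return_pmf Acc}) \<le> real (v + 1)"
        using few[OF v False] by (metis of_nat_le_iff of_nat_mult)
      then show ?thesis using k by (simp add: field_simps)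
    qed
    finally show ?thesis using False by simp
  qed
  have "pmf res Acc = (\<Sum>v<M. pmf (pmf_of_set {..<v + 1} \<bind> g v) Acc) / card {..<M}"
    unfolding res_def using ne by (intro pmf_bind_pmf_of_set) auto
  also have "\<dots> \<le> (\<Sum>v<M. indicator X (v + 1) + 1 / k) / card {..<M}"
    using inner by (intro divide_right_mono sum_mono) auto
  also have "(\<Sum>v<M. indicator X (v + 1) + 1 / k) = real (card {v \<in> {..<M}. v + 1 \<in> X}) + M / k"
    by (simp add: sum.distrib indicator_def sum.If_cases Int_def)
  also have "card {v \<in> {..<M}. v + 1 \<in> X} \<le> card X"
    using X by (intro card_inj_on_le[of "\<lambda>v. v + 1"]) auto
  finally have "pmf res Acc \<le> (real (card X) + M / k) / M"
    by (simp add: divide_right_mono)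
  also have "\<dots> = card X / M + 1 / k" using M by (simp add: field_simps)
  finally have "pmf res Acc \<le> card X / M + 1 / k" .
  moreover have "pmf res Acc + pmf res Rej = 1"
    using sum_pmf_eq_1[OF _ set] by simp
  ultimately show "pmf res Rej \<ge> 1 - (card X / M + 1 / k)" by linarith
qed

theorem theorem1:
  fixes \<sigma> :: nat
  shows "\<exists>(prog :: instr list) (c :: nat).
    \<forall>T P :: nat list. set T \<subseteq> {..<\<sigma>} \<longrightarrow> set P \<subseteq> {..<\<sigma>} \<longrightarrow>
      (let n = length T; m = length P;
           res = outcome prog T P ((n + 2) ^ c) (c * (n + m + 1))
       in pmf res Fail = 0 \<and>
          pmf res (if sublist P T then Acc else Rej) \<ge> 99 / 100)"
proof -
  \<comment> \<open>For y = N ^ a with N = n + 2, the range M = N ^ E of the moduli is y ^ (2 h).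
    Smooth moduli then have probability at most 4 / h + 1 / y ^ h, and h = 1000 makes the first term
    0.004. The constant c covers the fuel and, as an exponent, the word bound.\<close>
  define a where "a = 10 + \<sigma>"
  define h :: nat where "h = 1000"
  define E where "E = a * (2 * h)"
  define c where "c = 5 * E + \<sigma> + 100"
  have "pmf (outcome (program E) T P ((length T + 2) ^ c) (c * (length T + length P + 1))) Fail = 0 \<and>
      pmf (outcome (program E) T P ((length T + 2) ^ c) (c * (length T + length P + 1)))
        (if sublist P T then Acc else Rej) \<ge> 99 / 100"
    if T: "set T \<subseteq> {..<\<sigma>}" and P: "set P \<subseteq> {..<\<sigma>}" for T P
  proof -
    let ?n = "length T" and ?m = "length P"
    let ?N = "?n + 2"
    let ?M = "?N ^ E"
    let ?res = "outcome (program E) T P (?N ^ c) (c * (?n + ?m + 1))"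
    define y where "y = ?N ^ a"
    obtain g where res: "?res = pmf_of_set {..<?M} \<bind> (\<lambda>v. pmf_of_set {..<v + 1} \<bind> g v)"
      and g': "\<And>v r. v < ?M \<Longrightarrow> r < v + 1 \<Longrightarrow> g v r = return_pmf Acc \<and>
        (\<exists>i. i + ?m \<le> ?n \<and> hash r (take ?m (drop i T)) mod (v + 1) = hash r P mod (v + 1)) \<or>
        g v r = return_pmf Rej \<and> \<not> sublist P T"
      using outcome_program[OF T P, of E c] c_def by blast
    have M0: "0 < ?M" by simp
    show ?thesis
    proof (cases "sublist P T")
      case True
      \<comment> \<open>An occurring pattern leaves acceptance as the only possibility for every q
        and r, so there is no error in this case.\<close>
      have "?res = pmf_of_set {..<?M} \<bind> (\<lambda>v. return_pmf Acc)"
        unfolding res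
      proof (rule bind_pmf_cong[OF refl])
        fix v assume "v \<in> set_pmf (pmf_of_set {..<?M})"
        then have v: "v < ?M" using M0 by (subst (asm) set_pmf_of_set) (auto simp: lessThan_empty_iff)
        have "pmf_of_set {..<v + 1} \<bind> g v = pmf_of_set {..<v + 1} \<bind> (\<lambda>r. return_pmf Acc)"
        proof (rule bind_pmf_cong[OF refl])
          fix r assume "r \<in> set_pmf (pmf_of_set {..<v + 1})"
          then have "r < v + 1" by (subst (asm) set_pmf_of_set) (auto simp: lessThan_empty_iff)
          then show "g v r = return_pmf Acc" using g'[OF v] True by blast
        qed
        then show "pmf_of_set {..<v + 1} \<bind> g v = return_pmf Acc" by simp
      qed
      then show ?thesis using True by simp
    next
      case False
      have "2 \<le> ?N" by simp
      note y = parameter_bounds[OF this a_def y_def]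
      have M: "?M = y ^ h * y ^ h"
        by (simp add: y_def E_def mult_2 distrib_left power_add power_mult)
      have "256 * (?n + 1) * ?n \<le> 256 * ?N * ?N" by (intro mult_le_mono) auto
      also have "\<dots> \<le> y" using y(2) by (simp only: power2_eq_square mult.assoc)
      finally have y256: "256 * (?n + 1) * ?n \<le> y" .
      have few: "256 * card {r \<in> {..<v + 1}. g v r = return_pmf Acc} \<le> v + 1"
        if v: "v < ?M" and s: "v + 1 \<notin> smooth_upto y ?M" for v
      proof -
        have "card {r \<in> {..<v + 1}. g v r = return_pmf Acc} \<le> card {r \<in> {..<v + 1}. \<exists>i. i + ?m \<le> ?n \<and>
            hash r (take ?m (drop i T)) mod (v + 1) = hash r P mod (v + 1)}"
        proof (intro card_mono subsetI)
          fix r assume "r \<in> {r \<in> {..<v + 1}. g v r = return_pmf Acc}"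
          then have "r < v + 1" "g v r = return_pmf Acc" by simp_all
          with g'[OF v this(1)] show "r \<in> {r \<in> {..<v + 1}. \<exists>i. i + ?m \<le> ?n \<and>
            hash r (take ?m (drop i T)) mod (v + 1) = hash r P mod (v + 1)}" by simp
        qed simp
        moreover have "256 * card {r \<in> {..<v + 1}. \<exists>i. i + ?m \<le> ?n \<and>
            hash r (take ?m (drop i T)) mod (v + 1) = hash r P mod (v + 1)} \<le> v + 1"
          using card_collisions_le[OF T P False y(1) y256 _ s] v by simp
        ultimately show ?thesis by linarith
      qed
      have gg: "g v r \<in> {return_pmf Acc, return_pmf Rej}" if "v < ?M" "r < v + 1" for v r
        using g'[OF that] by blast
      have fin: "finite (smooth_upto y ?M)" by (simp add: smooth_upto_def)
      have two: "pmf ?res Fail = 0" "pmf ?res Rej \<ge> 1 - (card (smooth_upto y ?M) / ?M + 1 / 256)"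
        using pmf_two_stage[of ?M g "smooth_upto y ?M" 256] M0 gg few fin unfolding res by auto
      have yh: "1024 \<le> real y ^ h"
      proof -
        have "real y \<le> real y ^ h" using y(3) by (intro self_le_power) (auto simp: h_def)
        moreover have "1024 \<le> real y" using y(3) by simp
        ultimately show ?thesis by linarith
      qed
      have "real (card (smooth_upto y ?M)) \<le> 4 * real ?M / real h + real y ^ h"
        using y(3) by (intro card_smooth_upto_le) (auto simp: h_def)
      also have "real y ^ h \<le> real ?M / 1024"
        using mult_right_mono[OF yh, of "real y ^ h"] unfolding M by simp
      \<comment> \<open>0.004 + 1/1024 is below 0.005.\<close>
      finally have "real (card (smooth_upto y ?M)) \<le> real ?M * (5 / 1000)"
        by (simp add: h_def)
      then have "card (smooth_upto y ?M) / ?M \<le> 5 / 1000"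
        using M0 by (simp add: divide_le_eq mult.commute)
      \<comment> \<open>The total error is at most 0.005 + 1/256 < 0.01.\<close>
      with two(2) have "99 / 100 \<le> pmf ?res Rej" by linarith
      with two(1) show ?thesis unfolding if_not_P[OF False] by (rule conjI)
    qed
  qed
  then show ?thesis unfolding Let_def by blast
qed

end
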